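(* Let $K$ be a convex body in $\mathbb{R}^d$ with $o\in\mathrm{int}(K)$, and let $\mu$ be the uniform probability measure (normalized Lebesgue measure) on $K$. Then for every $0<t<\sqrt2$, \[F(t):=\mu\otimes\mu\{(x,y)\in K\times K:\|x-y\|_K\le t\}\le\left(\frac{t^2(4-t^2)}{4}\right)^{d/2}.\]
   Context: A convex body is a compact convex set with non-empty interior. $\|x\|_K=\inf\{\lambda>0:x\in\lambda K\}$ (a possibly asymmetric norm). *)

theory Defs
  imports "HOL-Analysis.Analysis" "HOL-Probability.Probability"
begin

definition convex_body :: "'a::euclidean_space set \<Rightarrow> bool" where
  "convex_body K \<longleftrightarrow> compact K \<and> convex K \<and> interior K \<noteq> {}"

definition gauge_norm :: "'a::euclidean_space set \<Rightarrow> 'a \<Rightarrow> real" where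
  "gauge_norm K x = Inf {r. r > 0 \<and> x \<in> (\<lambda>v. r *\<^sub>R v) ` K}"

end

theory Submission
  imports Defs
begin

text \<open>
  The volume of the pairs $x, y \in K$ with $x - y \in tK$ is the integral of
  $1_K(x) 1_K(y) 1_{tK}(x - y)$, and the bound is Young's convolution inequality with its sharp
  constant, for exponents optimized in \<open>t\<close>. The product structure reduces it to real
  functions, where it is proved by transport, after Barthe: let \<open>S1\<close>, \<open>S2\<close> transport a standard
  Gaussian to \<open>f\<close> and \<open>g\<close>, and let \<open>T\<close> transport \<open>h\<close> to a centred Gaussian of standard deviation
  \<open>t\<close>. In the coordinates $p, q$ with $x = S_1 p$, $y = S_2 q$, and then $u = p + q$ and
  $w = \rho (p - q) + s\, T (S_1 p - S_2 q)$, the arithmetic-geometric mean inequality bounds the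
  Jacobian of $w$ in $p$ from below and convexity of the square bounds the Gaussian factors from
  above; what remains is the integral of a product of two Gaussian densities in $u$ and $w$.
\<close>

subsection \<open>Monotone transport between positive densities\<close>

text \<open>Strict positivity and continuity make the distribution function a C^1 bijection onto
  (0,1) with positive derivative. Transport maps built from it are then differentiable at every
  point, not only almost everywhere.\<close>

locale positive_density =
  fixes f :: "real \<Rightarrow> real"
  assumes pos: "\<And>x. f x > 0"
    and cont: "continuous_on UNIV f"
    and int: "integrable lborel f"
    and int1: "(LINT x|lborel. f x) = 1"
begin

lemma meas[measurable]: "f \<in> borel_measurable borel"
  using cont by (rule borel_measurable_continuous_onI)

definition F :: "real \<Rightarrow> real" where "F = cdf (density lborel f)"

sublocale D: real_distribution "density lborel f"
proof -
  have "prob_space (density lborel f)"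
    by (rule prob_spaceI) (simp add: emeasure_density nn_integral_eq_integral[OF int] pos less_imp_le int1)
  then show "real_distribution (density lborel f)"
    by (simp add: real_distribution_def real_distribution_axioms_def)
qed

lemma F_diff:
  assumes "a \<le> x" shows "F x = F a + integral {a..x} f"
proof -
  have set: "set_integrable lborel {a..x} f"
    by (rule set_integrable_subset[of _ UNIV]) (use int in \<open>auto simp: set_integrable_def\<close>)
  have "F x - F a = measure (density lborel f) {a<..x}" if "a < x"
    unfolding F_def by (rule D.cdf_diff_eq[OF that])
  moreover have "measure (density lborel f) {a<..x} = integral {a..x} f"
  proof -
    have "emeasure (density lborel f) {a<..x} = (\<integral>\<^sup>+y. ennreal (f y * indicator {a..x} y) \<partial>lborel)"
    proof (subst emeasure_density)
      have "AE y in lborel. y \<noteq> a" by (rule AE_lborel_singleton)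
      then show "(\<integral>\<^sup>+y\<in>{a<..x}. ennreal (f y)\<partial>lborel) = (\<integral>\<^sup>+y. ennreal (f y * indicator {a..x} y) \<partial>lborel)"
        by (intro nn_integral_cong_AE, eventually_elim) (auto split: split_indicator)
    qed auto
    also have "\<dots> = ennreal (LINT y:{a..x}|lborel. f y)"
      using set unfolding set_integrable_def set_lebesgue_integral_def
      by (subst nn_integral_eq_integral) (auto simp: mult.commute pos less_imp_le)
    also have "(LINT y:{a..x}|lborel. f y) = integral {a..x} f"
      using set by (rule set_borel_integral_eq_integral)
    finally show ?thesis
      unfolding measure_def
      by (simp add: integral_nonneg pos less_imp_le integrable_continuous_interval continuous_on_subset[OF cont])
  qed
  ultimately show ?thesis using assms by (cases "a = x") auto
qed

text \<open>Fundamental theorem of calculus; the base point \<open>x-1\<close> lies strictly to the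
  left of \<open>x\<close>, so that the one-sided statement on an interval becomes a two-sided
  derivative at an interior point.\<close>

lemma F_deriv: "(F has_real_derivative f x) (at x)"
proof -
  have "((\<lambda>u. integral {x-1..u} f) has_real_derivative f x) (at x within {x-1..x+1})"
    by (rule integral_has_real_derivative) (auto intro: continuous_on_subset[OF cont])
  then have "((\<lambda>u. F (x-1) + integral {x-1..u} f) has_real_derivative f x) (at x within {x-1..x+1})"
    by (auto intro!: derivative_eq_intros)
  then have "(F has_real_derivative f x) (at x within {x-1..x+1})"
    by (rule has_field_derivative_transform_within[OF _ zero_less_one]) (auto simp: F_diff)
  then show ?thesis
    by (subst (asm) at_within_interior) auto
qed

lemma F_strict_mono: "x < y \<Longrightarrow> F x < F y"
  by (rule DERIV_pos_imp_increasing) (auto intro: F_deriv pos)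

lemma F_inj: "F x = F y \<Longrightarrow> x = y"
  using F_strict_mono[of x y] F_strict_mono[of y x] by (cases x y rule: linorder_cases) auto

text \<open>A distribution function stays in [0,1], and attaining an endpoint at \<open>x\<close>
  would push it out of [0,1] at \<open>x-1\<close> or \<open>x+1\<close> by strict
  monotonicity.\<close>

lemma F_range: "0 < F x" "F x < 1"
proof -
  have "0 \<le> F y" "F y \<le> 1" for y
    by (auto simp: F_def cdf_def)
  then show "0 < F x" "F x < 1"
    using F_strict_mono[of "x-1" x] F_strict_mono[of x "x+1"] by (smt (verit))+
qed

lemma F_surj: assumes "0 < u" "u < 1" obtains x where "F x = u"
proof -
  have "(F \<longlongrightarrow> 0) at_bot" "(F \<longlongrightarrow> 1) at_top"
    unfolding F_def by (rule D.cdf_lim_at_bot D.cdf_lim_at_top_prob)+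
  then have "\<forall>\<^sub>F x in at_bot. F x < u" "\<forall>\<^sub>F x in at_top. F x > u"
    using assms by (auto dest: order_tendstoD)
  then obtain a b where ab: "F a < u" "u < F b"
    by (metis eventually_at_bot_linorder eventually_at_top_linorder order_refl)
  have "a \<le> b" using ab F_strict_mono[of b a] by (cases "a \<le> b") auto
  then obtain x where "F x = u"
    using IVT[of F a u b] ab F_deriv by (meson DERIV_isCont less_imp_le)
  then show ?thesis by (rule that)
qed

text \<open>The quantile function. \<open>inv\<close> is unspecified off the range of
  \<open>F\<close>, so the facts on \<open>F (Q u)\<close> and on the derivative of \<open>Q\<close>
  are restricted to 0 < u < 1.\<close>

definition Q :: "real \<Rightarrow> real" where "Q = inv F"

lemma Q_F [simp]: "Q (F x) = x"
  unfolding Q_def by (rule inv_f_f) (auto intro: injI F_inj)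

lemma F_Q: "0 < u \<Longrightarrow> u < 1 \<Longrightarrow> F (Q u) = u"
  by (metis F_surj Q_F)

lemma Q_deriv:
  assumes "0 < u" "u < 1"
  shows "(Q has_real_derivative inverse (f (Q u))) (at u)"
proof (rule DERIV_inverse_function[where f=F])
  show "(F has_real_derivative f (Q u)) (at (Q u))" by (rule F_deriv)
  show "f (Q u) \<noteq> 0" using pos[of "Q u"] by simp
  have "isCont Q (F (Q u))"
    by (rule isCont_inverse_function[OF zero_less_one]) (auto intro: DERIV_isCont F_deriv)
  then show "isCont Q u" using F_Q assms by simp
qed (use assms F_Q in auto)

end

text \<open>The map T is the quantile function of \<open>g\<close> after the distribution function
  of \<open>f\<close>; the density identity comes from differentiating G (T x) = F x, where F and G
  are the two distribution functions.\<close>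

lemma monotone_transport:
  assumes "positive_density f" "positive_density g"
  obtains T T' where "\<And>x. (T has_real_derivative T' x) (at x)" "\<And>x. T' x > 0"
    "\<And>x. f x = T' x * g (T x)" "continuous_on UNIV T'" "surj T"
proof -
  interpret f: positive_density f by fact
  interpret g: positive_density g by fact
  define T where "T x = g.Q (f.F x)" for x
  define T' where "T' x = f x / g (T x)" for x
  have T': "(T has_real_derivative T' x) (at x)" for x
    unfolding T_def T'_def using DERIV_chain2[OF g.Q_deriv f.F_deriv, of x] f.F_range[of x]
    by (simp add: field_simps)
  have "continuous_on UNIV T"
    using T' by (auto intro: DERIV_continuous_on)
  then have "continuous_on UNIV T'"
    unfolding T'_def using g.pos
    by (intro continuous_intros f.cont continuous_on_compose2[OF g.cont]) (auto simp: less_imp_neq[symmetric])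
  moreover have "surj T"
  proof (rule surjI)
    fix y show "T (f.Q (g.F y)) = y"
      using g.F_range[of y] by (simp add: T_def f.F_Q)
  qed
  moreover have "f x = T' x * g (T x)" "T' x > 0" for x
    using g.pos[of "T x"] f.pos by (auto simp: T'_def)
  ultimately show ?thesis using that T' by metis
qed

text \<open>Substitution on the compact intervals [-n, n], followed by monotone convergence.
  Surjectivity of \<open>g\<close> is what makes the image intervals [g (-n), g n] exhaust the
  line.\<close>

lemma nn_integral_substitution_real:
  fixes g g' :: "real \<Rightarrow> real" and h :: "real \<Rightarrow> ennreal"
  assumes [measurable]: "h \<in> borel_measurable borel"
    and deriv: "\<And>x. (g has_real_derivative g' x) (at x)"
    and cont: "continuous_on UNIV g'" and nonneg: "\<And>x. g' x \<ge> 0"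
    and surj: "surj g"
  shows "(\<integral>\<^sup>+x. h x \<partial>lborel) = (\<integral>\<^sup>+x. h (g x) * g' x \<partial>lborel)"
proof -
  have mono: "g x \<le> g y" if "x \<le> y" for x y
    using deriv nonneg that by (auto intro: DERIV_nonneg_imp_nondecreasing)
  have [measurable]: "g \<in> borel_measurable borel" "g' \<in> borel_measurable borel"
    using cont deriv by (auto intro!: borel_measurable_continuous_onI DERIV_continuous_on)
  have lim: "(\<integral>\<^sup>+x. k x \<partial>lborel) = (SUP n::nat. \<integral>\<^sup>+x. k x * indicator {a n..b n} x \<partial>lborel)"
    if [measurable]: "k \<in> borel_measurable borel" and ab: "decseq a" "incseq b" "\<And>x. \<exists>n. a n \<le> x \<and> x \<le> b n"
    for k :: "real \<Rightarrow> ennreal" and a b :: "nat \<Rightarrow> real"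
  proof -
    have inc: "incseq (\<lambda>n x. k x * indicator {a n..b n} x)"
      using ab(1,2) by (auto simp: incseq_def decseq_def le_fun_def intro!: mult_left_mono split: split_indicator) (meson order_trans)+
    have "(SUP n. k x * indicator {a n..b n} x) = k x" for x
    proof (rule antisym)
      obtain n where n: "a n \<le> x" "x \<le> b n" using ab(3) by blast
      show "k x \<le> (SUP n. k x * indicator {a n..b n} x)"
        by (rule SUP_upper2[of n]) (use n in auto)
      show "(SUP n. k x * indicator {a n..b n} x) \<le> k x"
        by (rule SUP_least) (auto split: split_indicator)
    qed
    then show ?thesis
      by (subst nn_integral_monotone_convergence_SUP[symmetric, OF inc]) auto
  qed
  have arch: "\<exists>n::nat. - real n \<le> x \<and> x \<le> real n" for x
    using real_arch_simple[of "\<bar>x\<bar>"] by (auto simp: abs_le_iff) (metis minus_le_iff)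
  have ex: "\<exists>n::nat. g (- real n) \<le> x \<and> x \<le> g (real n)" for x
  proof -
    obtain y where y: "x = g y" using surj by (metis surjD)
    obtain n :: nat where "\<bar>y\<bar> \<le> n" using real_arch_simple by blast
    then show ?thesis using y by (intro exI[of _ n]) (auto intro!: mono)
  qed
  have "(\<integral>\<^sup>+x. h x \<partial>lborel) = (SUP n::nat. \<integral>\<^sup>+x. h x * indicator {g (- real n)..g (real n)} x \<partial>lborel)"
    by (rule lim) (auto simp: decseq_def incseq_def ex intro!: mono)
  also have "\<dots> = (SUP n::nat. \<integral>\<^sup>+x. (h (g x) * g' x) * indicator {- real n..real n} x \<partial>lborel)"
  proof (intro SUP_cong refl)
    fix n :: nat
    show "(\<integral>\<^sup>+x. h x * indicator {g (- real n)..g (real n)} x \<partial>lborel) =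
      (\<integral>\<^sup>+x. (h (g x) * g' x) * indicator {- real n..real n} x \<partial>lborel)"
    \<comment> \<open>Substitution on an interval requires distinct endpoints; for n = 0 both
      integrals run over a single point and vanish.\<close>
    proof (cases "n = 0")
      case False
      then show ?thesis
        by (intro nn_integral_substitution_aux) (auto intro: deriv nonneg continuous_on_subset[OF cont])
    next
      case True
      have "(\<integral>\<^sup>+x. k x * indicator {c..c} x \<partial>lborel) = 0" for k :: "real \<Rightarrow> ennreal" and c
        by (rule nn_integral_null_set) (auto simp: null_sets_def)
      then show ?thesis using True by simp
    qed
  qed
  also have "\<dots> = (\<integral>\<^sup>+x. h (g x) * g' x \<partial>lborel)"
    by (rule lim[symmetric]) (auto simp: decseq_def incseq_def arch)
  finally show ?thesis .
qed

subsection \<open>Sharp Young inequality on the real line\<close>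

text \<open>A derivative bounded below by c > 0 forces at least linear growth in both directions, so
  the intermediate value theorem reaches every value.\<close>

lemma surj_if_deriv_ge:
  fixes W W' :: "real \<Rightarrow> real"
  assumes deriv: "\<And>x. (W has_real_derivative W' x) (at x)" and "c > 0" and ge: "\<And>x. W' x \<ge> c"
  shows "surj W"
proof -
  have grow: "W y - W x \<ge> c * (y - x)" if "x \<le> y" for x y
  proof -
    have "W x - c * x \<le> W y - c * y"
      by (rule DERIV_nonneg_imp_nondecreasing[OF that])
        (auto intro!: exI derivative_eq_intros deriv simp: ge)
    then show ?thesis by (simp add: algebra_simps)
  qed
  have "\<exists>x. W x = v" for v
  proof -
    \<comment> \<open>Growth at rate \<open>c\<close> over the distance \<open>R\<close> covers
      exactly the gap between \<open>W 0\<close> and \<open>v\<close>.\<close>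
    define R where "R = \<bar>v - W 0\<bar> / c"
    have "R \<ge> 0" "c * R = \<bar>v - W 0\<bar>" using \<open>c > 0\<close> by (auto simp: R_def)
    then have "W (-R) \<le> v" "v \<le> W R" using grow[of 0 R] grow[of "-R" 0] by auto
    then show ?thesis
      using IVT[of W "-R" v R] \<open>R \<ge> 0\<close> deriv DERIV_isCont by (smt (verit))
  qed
  then show ?thesis by (metis surjI)
qed

text \<open>The weighted arithmetic-geometric mean inequality for 1, x, y with weights 1 - s, s/2,
  s/2. The number \<open>m\<close> is the weighted mean of the logarithms 0, ln x, ln y; averaging
  the tangent line of exp at \<open>m\<close> over these three points leaves exp m, since the linear
  terms cancel.\<close>

lemma weighted_am_gm:
  fixes x y s :: real
  assumes "x > 0" "y > 0" "0 < s" "s < 1"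
  shows "x powr (s / 2) * y powr (s / 2) \<le> 1 - s + s / 2 * x + s / 2 * y"
proof -
  define m where "m = s / 2 * (ln x + ln y)"
  have tangent: "exp z \<ge> exp m * (1 + z - m)" for z
    using exp_ge_add_one_self[of "z - m"] by (simp add: exp_diff field_simps)
  have "x powr (s / 2) * y powr (s / 2) = exp m"
    using assms by (simp add: powr_def exp_add[symmetric] m_def algebra_simps)
  also have "\<dots> = (1 - s) * (exp m * (1 + 0 - m)) + s / 2 * (exp m * (1 + ln x - m))
      + s / 2 * (exp m * (1 + ln y - m))"
  proof -
    have "exp m = exp m * (1 + s / 2 * (ln x + ln y) - m)" by (simp add: m_def)
    also have "\<dots> = (1 - s) * (exp m * (1 + 0 - m)) + s / 2 * (exp m * (1 + ln x - m))
      + s / 2 * (exp m * (1 + ln y - m))"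
      by (simp add: field_simps)
    finally show ?thesis .
  qed
  also have "\<dots> \<le> (1 - s) * exp 0 + s / 2 * exp (ln x) + s / 2 * exp (ln y)"
    using assms by (intro add_mono mult_left_mono tangent) auto
  finally show ?thesis using assms by simp
qed

text \<open>With the normalization moved into the exponent, products and powers of Gaussian
  densities can be compared by comparing sums of exponents.\<close>

lemma normal_density_eq_exp:
  assumes "\<sigma> > 0"
  shows "normal_density 0 \<sigma> x = exp (- x\<^sup>2 / (2 * \<sigma>\<^sup>2) - ln \<sigma> - ln (2 * pi) / 2)"
proof -
  have "sqrt (2 * pi * \<sigma>\<^sup>2) = exp (ln \<sigma> + ln (2 * pi) / 2)"
    using assms by (simp add: real_sqrt_mult exp_add ln_sqrt[symmetric])
  then show ?thesis
    by (simp add: normal_density_def exp_diff exp_add)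
qed

lemma normal_density_powr:
  assumes "\<sigma> > 0"
  shows "normal_density 0 \<sigma> x powr a = exp (a * (- x\<^sup>2 / (2 * \<sigma>\<^sup>2) - ln \<sigma> - ln (2 * pi) / 2))"
  using assms by (simp add: normal_density_eq_exp powr_def)

text \<open>
  The exponents satisfy $2a + s = 2$. The standard deviation \<open>\<sigma>\<close> is the one for which centred
  Gaussians of standard deviations $1, 1, \sigma$ give equality in both pointwise bounds below;
  in the theorem \<open>\<sigma>\<close> is \<open>t\<close>.
\<close>

locale young_exponents =
  fixes \<rho> a s \<sigma> :: real
  assumes rho: "0 < \<rho>" "\<rho> < 1"
    and a_def: "a = (1 + \<rho>) / 2" and s_def: "s = 1 - \<rho>" and sigma_def: "\<sigma> = sqrt (2 * \<rho> / a)"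
begin

text \<open>The sharp constant: the value of the double integral in
  \<open>young_positive_density\<close> when the three densities are centred Gaussians of standard
  deviations 1, 1, \<sigma>.\<close>

definition C :: real where "C = sqrt \<rho> / a * \<sigma> powr (- s)"

lemma bounds: "0 < a" "0 < s" "s < 1" "0 < \<sigma>"
  using rho by (auto simp: a_def s_def sigma_def)

lemma C_pos: "C > 0"
  using rho bounds by (simp add: C_def)

text \<open>In the exponents, p^2 + q^2 splits into squares of p + q and p - q, and convexity of the
  square with weights \<rho> and s = 1 - \<rho> merges the squares of p - q and \<theta>. Equality
  holds for \<theta> = p - q.\<close>

lemma gaussian_bound:
  "normal_density 0 1 p powr a * normal_density 0 1 q powr a * normal_density 0 \<sigma> \<theta> powr s
    \<le> 2 * C * normal_density 0 (sqrt (2 / a)) (p + q) * normal_density 0 \<sigma> (\<rho> * (p - q) + s * \<theta>)"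
proof -
  have sq: "\<sigma>\<^sup>2 = 2 * \<rho> / a" "(sqrt (2 / a))\<^sup>2 = 2 / a"
    using rho bounds by (auto simp: sigma_def)
  \<comment> \<open>This is the ratio of the normalizing constants of the two sides; because 2a + s
    = 2, the powers of 2 pi agree and only the standard deviations remain.\<close>
  have "2 * C = exp (ln \<sigma> + ln (sqrt (2 / a)) - s * ln \<sigma>)"
    using bounds rho by (simp add: C_def powr_def exp_add exp_diff exp_minus field_simps)
     (simp add: sigma_def real_sqrt_mult real_sqrt_divide field_simps)
  then have C: "2 * C * normal_density 0 (sqrt (2 / a)) (p + q) * normal_density 0 \<sigma> (\<rho> * (p - q) + s * \<theta>)
     = exp (ln \<sigma> + ln (sqrt (2 / a)) - s * ln \<sigma>
         + (- (p + q)\<^sup>2 / (2 * (2 / a)) - ln (sqrt (2 / a)) - ln (2 * pi) / 2)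
         + (- (\<rho> * (p - q) + s * \<theta>)\<^sup>2 / (2 * \<sigma>\<^sup>2) - ln \<sigma> - ln (2 * pi) / 2))"
    using bounds by (simp only: normal_density_eq_exp real_sqrt_gt_0_iff divide_pos_pos exp_add sq zero_less_numeral)
  \<comment> \<open>The exact convexity defect of the square, nonnegative after the minus sign is
    set aside.\<close>
  have *: "(\<rho> * (p - q) + s * \<theta>)\<^sup>2 = \<rho> * (p - q)\<^sup>2 + s * \<theta>\<^sup>2 - \<rho> * s * (p - q - \<theta>)\<^sup>2"
    by (simp add: s_def power2_eq_square algebra_simps)
  have "(\<rho> * (p - q) + s * \<theta>)\<^sup>2 \<le> \<rho> * (p - q)\<^sup>2 + s * \<theta>\<^sup>2"
    unfolding * using rho bounds by simp
  then have "a / (4 * \<rho>) * (\<rho> * (p - q) + s * \<theta>)\<^sup>2 \<le> a / (4 * \<rho>) * (\<rho> * (p - q)\<^sup>2 + s * \<theta>\<^sup>2)"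
    using rho bounds by (intro mult_left_mono) auto
  also have "\<dots> = a / 4 * (p - q)\<^sup>2 + s * (a / (4 * \<rho>) * \<theta>\<^sup>2)"
    using rho by (simp add: field_simps)
  finally have le: "a / (4 * \<rho>) * (\<rho> * (p - q) + s * \<theta>)\<^sup>2 \<le> a / 4 * (p - q)\<^sup>2 + s * (a / (4 * \<rho>) * \<theta>\<^sup>2)" .
  have "a * (p\<^sup>2 / 2) + a * (q\<^sup>2 / 2) = a / 4 * (p - q)\<^sup>2 + a / 4 * (p + q)\<^sup>2"
    by (simp add: power2_eq_square algebra_simps)
  moreover have "a * L + a * L + s * L = 2 * L" for L
    by (simp add: a_def s_def algebra_simps)
  from this[of "ln (2 * pi) / 2"]
  have "a * (ln (2 * pi) / 2) + a * (ln (2 * pi) / 2) + s * (ln (2 * pi) / 2) = ln (2 * pi)" by simp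
  moreover have "X / (2 * \<sigma>\<^sup>2) = a / (4 * \<rho>) * X" for X
    using rho bounds by (simp add: sq field_simps)
  moreover have "X / (2 * (2 / a)) = a / 4 * X" for X
    by simp
  ultimately show ?thesis using le
    unfolding C normal_density_powr[OF zero_less_one] normal_density_powr[OF bounds(4)]
      exp_add[symmetric] exp_le_cancel_iff
    by (simp add: right_diff_distrib minus_divide_left[symmetric] ac_simps)
qed

text \<open>
  Here \<open>x1\<close>, \<open>x2\<close>, \<open>x3\<close> are the derivatives of \<open>S1\<close>, \<open>S2\<close>, \<open>T\<close>, and the last factor is the
  derivative of $w$ in \<open>p\<close> for fixed $u = p + q$.
\<close>

lemma young_pointwise:
  fixes p q \<theta> x1 x2 x3 :: real
  assumes "x1 > 0" "x2 > 0" "x3 > 0"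
    and f: "normal_density 0 1 p = x1 * f" and g: "normal_density 0 1 q = x2 * g"
    and h: "h = x3 * normal_density 0 \<sigma> \<theta>"
  shows "f powr a * g powr a * h powr s * x1 * x2
    \<le> C * normal_density 0 (sqrt (2 / a)) (p + q) *
       (normal_density 0 \<sigma> (\<rho> * (p - q) + s * \<theta>) * (2 * \<rho> + s * (x3 * (x1 + x2))))"
proof -
  have pos: "f > 0" "g > 0"
    using assms(1,2) f g normal_density_pos[of 1 0] by (metis zero_less_one zero_less_mult_pos)+
  \<comment> \<open>Since a + s/2 = 1, each of x1 and x2 splits into a power \<open>a\<close>, which
    turns \<open>f\<close> or \<open>g\<close> into a Gaussian, and a power \<open>s / 2\<close>,
    which combines with half of x3 powr s into a factor of the geometric mean.\<close>
  have a: "a = 1 - s / 2" by (simp add: a_def s_def field_simps)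
  have x: "x powr a * x powr (s / 2) = x" if "x > 0" for x :: real
    using that by (simp add: a powr_add[symmetric])
  have "(f powr a * g powr a * h powr s) * x1 * x2
      = (f powr a * g powr a * h powr s) * (x1 powr a * x1 powr (s / 2)) * (x2 powr a * x2 powr (s / 2))"
    using assms by (simp add: x)
  also have "\<dots> = normal_density 0 1 p powr a * normal_density 0 1 q powr a * normal_density 0 \<sigma> \<theta> powr s
      * ((x3 * x1) powr (s / 2) * (x3 * x2) powr (s / 2))"
  proof -
    have "x3 powr s = x3 powr (s / 2) * x3 powr (s / 2)"
      using assms by (simp add: powr_add[symmetric])
    then show ?thesis using assms pos by (simp add: powr_mult f g h)
  qed
  \<comment> \<open>The two bounds are multiplied. The factor 2 and 1 - s = \<rho> then turn the
    arithmetic mean into the derivative of w.\<close>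
  also have "\<dots> \<le> (2 * C * normal_density 0 (sqrt (2 / a)) (p + q) * normal_density 0 \<sigma> (\<rho> * (p - q) + s * \<theta>))
      * (1 - s + s / 2 * (x3 * x1) + s / 2 * (x3 * x2))"
    using assms bounds C_pos by (intro mult_mono gaussian_bound weighted_am_gm) auto
  also have "\<dots> = C * normal_density 0 (sqrt (2 / a)) (p + q) *
       (normal_density 0 \<sigma> (\<rho> * (p - q) + s * \<theta>) * (2 * \<rho> + s * (x3 * (x1 + x2))))"
    by (simp add: s_def field_simps)
  finally show ?thesis .
qed

text \<open>After the pointwise bound, for each fixed u the integral over p is the total mass of a
  Gaussian in the variable w, hence 1; the integral over u then yields \<open>C\<close> times the
  mass of another Gaussian.\<close>

lemma young_positive_density:
  assumes "positive_density f" "positive_density g" "positive_density h"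
  shows "(\<integral>\<^sup>+x. \<integral>\<^sup>+y. ennreal (f x powr a * g y powr a * h (x - y) powr s) \<partial>lborel \<partial>lborel) \<le> ennreal C"
proof -
  interpret f: positive_density f by fact
  interpret g: positive_density g by fact
  interpret h: positive_density h by fact
  have normal: "positive_density (normal_density 0 \<tau>)" if "\<tau> > 0" for \<tau>
  proof
    show "continuous_on UNIV (normal_density 0 \<tau>)"
      unfolding normal_density_def[abs_def] using that by (auto intro!: continuous_intros)
  qed (use that normal_density_pos in auto)
  obtain S1 S1' where S1: "\<And>x. (S1 has_real_derivative S1' x) (at x)" "\<And>x. S1' x > 0"
    "\<And>x. normal_density 0 1 x = S1' x * f (S1 x)" "continuous_on UNIV S1'" "surj S1"
    using monotone_transport[OF normal[OF zero_less_one] assms(1)] by metis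
  obtain S2 S2' where S2: "\<And>x. (S2 has_real_derivative S2' x) (at x)" "\<And>x. S2' x > 0"
    "\<And>x. normal_density 0 1 x = S2' x * g (S2 x)" "continuous_on UNIV S2'" "surj S2"
    using monotone_transport[OF normal[OF zero_less_one] assms(2)] by metis
  obtain T T' where T: "\<And>x. (T has_real_derivative T' x) (at x)" "\<And>x. T' x > 0"
    "\<And>x. h x = T' x * normal_density 0 \<sigma> (T x)" "continuous_on UNIV T'" "surj T"
    using monotone_transport[OF assms(3) normal[OF bounds(4)]] by metis
  have cont: "continuous_on UNIV S1" "continuous_on UNIV S2" "continuous_on UNIV T"
    using S1(1) S2(1) T(1) by (auto intro: DERIV_continuous_on)
  note [measurable] = cont[THEN borel_measurable_continuous_onI]
    S1(4)[THEN borel_measurable_continuous_onI] S2(4)[THEN borel_measurable_continuous_onI]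
    T(4)[THEN borel_measurable_continuous_onI]
  define E where "E p q = f (S1 p) powr a * g (S2 q) powr a * h (S1 p - S2 q) powr s * S1' p * S2' q" for p q
  define W where "W u p = \<rho> * (p - (u - p)) + s * T (S1 p - S2 (u - p))" for u p
  define W' where "W' u p = 2 * \<rho> + s * (T' (S1 p - S2 (u - p)) * (S1' p + S2' (u - p)))" for u p
  let ?N = "normal_density 0 (sqrt (2 / a))"
  let ?N' = "normal_density 0 \<sigma>"
  have [measurable]: "(\<lambda>(p, q). E p q) \<in> borel_measurable (lborel \<Otimes>\<^sub>M lborel)"
    "(\<lambda>(u, p). W u p) \<in> borel_measurable (lborel \<Otimes>\<^sub>M lborel)"
    "(\<lambda>(u, p). W' u p) \<in> borel_measurable (lborel \<Otimes>\<^sub>M lborel)"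
    unfolding E_def W_def W'_def by measurable
  have W: "(W u has_real_derivative W' u p) (at p)" for u p
    unfolding W_def W'_def
    by (rule derivative_eq_intros DERIV_chain2[OF T(1)] DERIV_chain2[OF S2(1)] S1(1) refl)+ (simp add: algebra_simps)
  \<comment> \<open>Being bounded below by a positive constant, the derivative makes
    \<open>W u\<close> onto, as the substitution requires.\<close>
  have W'_ge: "W' u p \<ge> 2 * \<rho>" for u p
    unfolding W'_def using bounds S1(2)[of p] S2(2)[of "u - p"] T(2)[of "S1 p - S2 (u - p)"]
    by (simp add: less_imp_le)
  have W'_cont: "continuous_on UNIV (W' u)" for u
    unfolding W'_def
    by (intro continuous_intros continuous_on_compose2[OF T(4)] continuous_on_compose2[OF S2(4)]
        continuous_on_compose2[OF cont(2)] S1(4) cont) auto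
  have N': "(\<integral>\<^sup>+p. ennreal (?N' (W u p) * W' u p) \<partial>lborel) = 1" for u
  proof -
    have "1 = (\<integral>\<^sup>+w. ennreal (?N' w) \<partial>lborel)"
      using bounds by (subst nn_integral_eq_integral) auto
    also have "\<dots> = (\<integral>\<^sup>+p. ennreal (?N' (W u p)) * ennreal (W' u p) \<partial>lborel)"
      using rho by (intro nn_integral_substitution_real W W'_cont surj_if_deriv_ge[OF W, of "2 * \<rho>"] W'_ge)
        (auto intro: order_trans[OF _ W'_ge])
    finally show ?thesis by (simp add: ennreal_mult'[symmetric] ennreal_mult''[symmetric])
  qed
  have "(\<integral>\<^sup>+x. \<integral>\<^sup>+y. ennreal (f x powr a * g y powr a * h (x - y) powr s) \<partial>lborel \<partial>lborel)
    = (\<integral>\<^sup>+p. (\<integral>\<^sup>+y. ennreal (f (S1 p) powr a * g y powr a * h (S1 p - y) powr s) \<partial>lborel) * S1' p \<partial>lborel)"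
    using S1 by (intro nn_integral_substitution_real) (auto intro: less_imp_le)
  also have "\<dots> = (\<integral>\<^sup>+p. (\<integral>\<^sup>+q. ennreal (f (S1 p) powr a * g (S2 q) powr a * h (S1 p - S2 q) powr s) * S2' q \<partial>lborel) * S1' p \<partial>lborel)"
    using S2 by (subst nn_integral_substitution_real[of _ S2 S2']) (auto intro: less_imp_le)
  also have "\<dots> = (\<integral>\<^sup>+p. \<integral>\<^sup>+q. ennreal (E p q) \<partial>lborel \<partial>lborel)"
    using S1(2) S2(2) by (subst nn_integral_multc[symmetric])
      (auto simp: E_def less_imp_le ennreal_mult'[symmetric] ennreal_mult''[symmetric] ac_simps)
  also have "\<dots> = (\<integral>\<^sup>+p. \<integral>\<^sup>+u. ennreal (E p (u - p)) \<partial>lborel \<partial>lborel)"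
  proof (rule nn_integral_cong)
    fix p :: real
    show "(\<integral>\<^sup>+q. ennreal (E p q) \<partial>lborel) = (\<integral>\<^sup>+u. ennreal (E p (u - p)) \<partial>lborel)"
      by (subst nn_integral_real_affine[where c=1 and t="- p"]) auto
  qed
  \<comment> \<open>With u = p + q as the outer variable, p can be replaced by w at fixed u.\<close>
  also have "\<dots> = (\<integral>\<^sup>+u. \<integral>\<^sup>+p. ennreal (E p (u - p)) \<partial>lborel \<partial>lborel)"
    by (rule lborel_pair.Fubini') measurable
  also have "\<dots> \<le> (\<integral>\<^sup>+u. \<integral>\<^sup>+p. ennreal (C * ?N u * (?N' (W u p) * W' u p)) \<partial>lborel \<partial>lborel)"
  proof (intro nn_integral_mono ennreal_leI)
    fix u p :: real
    show "E p (u - p) \<le> C * ?N u * (?N' (W u p) * W' u p)"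
      using young_pointwise[OF S1(2) S2(2) T(2) S1(3) S2(3) T(3), of p "u - p" "S1 p - S2 (u - p)"]
      by (simp add: E_def W_def W'_def)
  qed
  also have "\<dots> = (\<integral>\<^sup>+u. ennreal (C * ?N u) * (\<integral>\<^sup>+p. ennreal (?N' (W u p) * W' u p) \<partial>lborel) \<partial>lborel)"
    using C_pos by (subst nn_integral_cmult[symmetric]) (auto simp: ennreal_mult')
  also have "\<dots> = ennreal C"
    unfolding N' using C_pos bounds
    by (simp add: ennreal_mult' nn_integral_cmult) (subst nn_integral_eq_integral; simp)
  finally show ?thesis .
qed

text \<open>Both sides are homogeneous of degrees a, a, s in f, g, h, so normalizing each function
  to integral 1 reduces to densities.\<close>

lemma young_positive:
  fixes f g h :: "real \<Rightarrow> real"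
  assumes "\<And>x. f x > 0" "continuous_on UNIV f" "integrable lborel f"
   and "\<And>x. g x > 0" "continuous_on UNIV g" "integrable lborel g"
   and "\<And>x. h x > 0" "continuous_on UNIV h" "integrable lborel h"
  shows "(\<integral>\<^sup>+x. \<integral>\<^sup>+y. ennreal (f x powr a * g y powr a * h (x - y) powr s) \<partial>lborel \<partial>lborel)
    \<le> ennreal (C * (integral\<^sup>L lborel f powr a * integral\<^sup>L lborel g powr a * integral\<^sup>L lborel h powr s))"
proof -
  have pos: "integral\<^sup>L lborel k > 0" if "\<And>x. k x > 0" "integrable lborel k" for k :: "real \<Rightarrow> real"
  proof -
    have "integral\<^sup>L lborel k \<noteq> 0"
      using that integral_nonneg_eq_0_iff_AE[OF that(2)]
      by (auto simp: less_imp_le less_imp_neq[symmetric] ae_filter_eq_bot_iff)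
    then show ?thesis
      using integral_nonneg_AE[of k lborel] that(1) by (simp add: less_le)
  qed
  have dens: "positive_density (\<lambda>x. k x / integral\<^sup>L lborel k)"
    if k: "\<And>x. k x > 0" "continuous_on UNIV k" "integrable lborel k" for k
    using pos[OF k(1,3)] k by unfold_locales (auto intro!: continuous_intros)
  let ?F = "integral\<^sup>L lborel f" let ?G = "integral\<^sup>L lborel g" let ?H = "integral\<^sup>L lborel h"
  have FGH: "?F > 0" "?G > 0" "?H > 0"
    by - (rule pos, rule assms, rule assms)+
  have [measurable]: "f \<in> borel_measurable borel" "g \<in> borel_measurable borel" "h \<in> borel_measurable borel"
    using assms by (auto intro: borel_measurable_continuous_onI)
  define c where "c = ?F powr a * ?G powr a * ?H powr s"
  have "c > 0" unfolding c_def using FGH by simp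
  have "(\<integral>\<^sup>+x. \<integral>\<^sup>+y. ennreal (f x powr a * g y powr a * h (x - y) powr s) \<partial>lborel \<partial>lborel)
    = (\<integral>\<^sup>+x. \<integral>\<^sup>+y. ennreal c * ennreal ((f x / ?F) powr a * (g y / ?G) powr a * (h (x - y) / ?H) powr s) \<partial>lborel \<partial>lborel)"
    using \<open>c > 0\<close> FGH
    by (intro nn_integral_cong, subst ennreal_mult[symmetric])
      (auto simp: powr_divide assms less_imp_le c_def ac_simps)
  also have "\<dots> = ennreal c * (\<integral>\<^sup>+x. \<integral>\<^sup>+y. ennreal ((f x / ?F) powr a * (g y / ?G) powr a * (h (x - y) / ?H) powr s) \<partial>lborel \<partial>lborel)"
    by (simp add: nn_integral_cmult)
  also have "\<dots> \<le> ennreal c * ennreal C"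
    by (intro mult_left_mono young_positive_density dens assms) auto
  finally show ?thesis
    using \<open>c > 0\<close> C_pos by (simp add: ennreal_mult' c_def mult.commute)
qed

end

section \<open>Passage from positive continuous to nonnegative measurable functions\<close>

lemma continuous_std_normal: "continuous_on UNIV std_normal_density"
  unfolding normal_density_def[abs_def] by (auto intro!: continuous_intros)

text \<open>A measurable function is an almost everywhere limit of continuous ones; clipping these
  between Gaussians makes them positive and uniformly dominated, so dominated convergence gives the
  limit of the integrals.\<close>

lemma positive_continuous_approx:
  fixes f :: "real \<Rightarrow> real"
  assumes [measurable]: "f \<in> borel_measurable borel"
    and f: "\<And>x. 0 \<le> f x" "\<And>x. f x \<le> M * std_normal_density x"
  obtains k :: "nat \<Rightarrow> real \<Rightarrow> real"
  where "\<And>n x. k n x > 0" "\<And>n. continuous_on UNIV (k n)" "\<And>n. integrable lborel (k n)"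
    "AE x in lborel. (\<lambda>n. k n x) \<longlonglongrightarrow> f x"
    "(\<lambda>n. integral\<^sup>L lborel (k n)) \<longlonglongrightarrow> integral\<^sup>L lborel f"
proof -
  have "f measurable_on UNIV"
    by (intro lebesgue_measurable_imp_measurable_on_nnreal_UNIV f(1)) (simp add: measurable_completion)
  then obtain N g where N: "negligible N" and g: "\<And>n. continuous_on UNIV (g n)"
    and lim: "\<And>x. x \<notin> N \<Longrightarrow> (\<lambda>n. g n x) \<longlonglongrightarrow> f x"
    unfolding measurable_on_def by auto
  \<comment> \<open>The minimum keeps the Gaussian envelope of \<open>f\<close>; the maximum with a
    multiple of the Gaussian that tends to 0 enforces positivity without changing the limit.\<close>
  define k where "k n x = max (std_normal_density x / Suc n) (min (M * std_normal_density x) (g n x))" for n x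
  have pos: "k n x > 0" for n x
    unfolding k_def by (auto simp: normal_density_pos less_max_iff_disj)
  have cont: "continuous_on UNIV (k n)" for n
    unfolding k_def by (intro continuous_intros continuous_on_max continuous_on_min continuous_std_normal g) auto
  then have meas: "k n \<in> borel_measurable lborel" for n
    by (simp add: borel_measurable_continuous_onI)
  have AE: "AE x in lborel. (\<lambda>n. k n x) \<longlonglongrightarrow> f x"
  proof -
    have "AE x in lebesgue. x \<notin> N"
      using N by (intro AE_not_in) (simp add: negligible_iff_null_sets)
    then have "AE x in lborel. x \<notin> N"
      by (simp add: AE_completion_iff)
    then show ?thesis
    proof eventually_elim
      case (elim x)
      have "(\<lambda>n. std_normal_density x / Suc n) \<longlonglongrightarrow> 0"
        using LIMSEQ_Suc[OF lim_const_over_n] by blast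
      then have "(\<lambda>n. k n x) \<longlonglongrightarrow> max 0 (min (M * std_normal_density x) (f x))"
        unfolding k_def by (intro tendsto_max tendsto_min lim[OF elim] tendsto_const)
      then show ?case using f[of x] by (simp add: min_absorb2 max_absorb2)
    qed
  qed
  have bound: "\<bar>k n x\<bar> \<le> (M + 1) * std_normal_density x" for n x
  proof -
    have "0 \<le> M * std_normal_density x" using f[of x] by linarith
    moreover have "std_normal_density x / Suc n \<le> std_normal_density x"
      by (simp add: field_simps mult_left_mono)
    moreover have "0 \<le> std_normal_density x" by simp
    ultimately show ?thesis
      using pos[of n x] unfolding k_def ring_distribs by (auto simp del: normal_density_nonneg)
  qed
  have int: "integrable lborel (k n)" for n
    by (rule Bochner_Integration.integrable_bound[where f="\<lambda>x. (M + 1) * std_normal_density x"])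
      (use bound[of n] meas in \<open>auto intro!: AE_I2 order_trans[OF bound abs_ge_self]\<close>)
  have "(\<lambda>n. integral\<^sup>L lborel (k n)) \<longlonglongrightarrow> integral\<^sup>L lborel f"
    by (rule integral_dominated_convergence[where w="\<lambda>x. (M + 1) * std_normal_density x"])
      (use meas AE bound in auto)
  then show ?thesis
    using that[OF pos cont int AE] by blast
qed

text \<open>Reflection preserves Lebesgue measure. This gives convergence of the approximants of
  \<open>h\<close> at x - y for every fixed x and almost every y.\<close>

lemma AE_lborel_reflect:
  fixes x :: real
  assumes "AE y in lborel. P y"
  shows "AE y in lborel. P (x - y)"
proof -
  have eq: "distr lborel borel (\<lambda>y. x - y) = lborel"
    using lborel_real_affine[of "-1" x] by (simp add: density_1)
  have "AE y in distr lborel borel (\<lambda>y. x - y). P y"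
    unfolding eq by (rule assms)
  then show ?thesis by (rule AE_distrD[rotated]) simp
qed

context young_exponents
begin

text \<open>Fatou's lemma, first in y and then in x, carries the inequality from the approximants to
  their limits; the integrals on the right converge.\<close>

lemma young_real:
  assumes [measurable]: "f \<in> borel_measurable borel" "g \<in> borel_measurable borel" "h \<in> borel_measurable borel"
    and f: "\<And>x. 0 \<le> f x" "\<And>x. f x \<le> M1 * std_normal_density x"
    and g: "\<And>x. 0 \<le> g x" "\<And>x. g x \<le> M2 * std_normal_density x"
    and h: "\<And>x. 0 \<le> h x" "\<And>x. h x \<le> M3 * std_normal_density x"
  shows "(\<integral>\<^sup>+x. \<integral>\<^sup>+y. ennreal (f x powr a * g y powr a * h (x - y) powr s) \<partial>lborel \<partial>lborel)
    \<le> ennreal (C * (integral\<^sup>L lborel f powr a * integral\<^sup>L lborel g powr a * integral\<^sup>L lborel h powr s))"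
proof -
  obtain f' where f': "\<And>n x. f' n x > 0" "\<And>n. continuous_on UNIV (f' n)" "\<And>n. integrable lborel (f' n)"
    "AE x in lborel. (\<lambda>n. f' n x) \<longlonglongrightarrow> f x" "(\<lambda>n. integral\<^sup>L lborel (f' n)) \<longlonglongrightarrow> integral\<^sup>L lborel f"
    by (rule positive_continuous_approx[OF assms(1) f]) (rule that)
  obtain g' where g': "\<And>n x. g' n x > 0" "\<And>n. continuous_on UNIV (g' n)" "\<And>n. integrable lborel (g' n)"
    "AE x in lborel. (\<lambda>n. g' n x) \<longlonglongrightarrow> g x" "(\<lambda>n. integral\<^sup>L lborel (g' n)) \<longlonglongrightarrow> integral\<^sup>L lborel g"
    by (rule positive_continuous_approx[OF assms(2) g]) (rule that)
  obtain h' where h': "\<And>n x. h' n x > 0" "\<And>n. continuous_on UNIV (h' n)" "\<And>n. integrable lborel (h' n)"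
    "AE x in lborel. (\<lambda>n. h' n x) \<longlonglongrightarrow> h x" "(\<lambda>n. integral\<^sup>L lborel (h' n)) \<longlonglongrightarrow> integral\<^sup>L lborel h"
    by (rule positive_continuous_approx[OF assms(3) h]) (rule that)
  note [measurable] = f'(2)[THEN borel_measurable_continuous_onI]
    g'(2)[THEN borel_measurable_continuous_onI] h'(2)[THEN borel_measurable_continuous_onI]
  have nonneg: "0 \<le> integral\<^sup>L lborel (k n)" if "\<And>n x. k n x > 0" for k :: "nat \<Rightarrow> real \<Rightarrow> real" and n
    using that by (intro Bochner_Integration.integral_nonneg) (auto intro: less_imp_le)
  let ?E' = "\<lambda>n x y. ennreal (f' n x powr a * g' n y powr a * h' n (x - y) powr s)"
  let ?R = "\<lambda>n. C * (integral\<^sup>L lborel (f' n) powr a * integral\<^sup>L lborel (g' n) powr a * integral\<^sup>L lborel (h' n) powr s)"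
  have "(\<integral>\<^sup>+x. \<integral>\<^sup>+y. ennreal (f x powr a * g y powr a * h (x - y) powr s) \<partial>lborel \<partial>lborel)
    \<le> (\<integral>\<^sup>+x. liminf (\<lambda>n. \<integral>\<^sup>+y. ?E' n x y \<partial>lborel) \<partial>lborel)"
  proof (rule nn_integral_mono_AE)
    show "AE x in lborel. (\<integral>\<^sup>+y. ennreal (f x powr a * g y powr a * h (x - y) powr s) \<partial>lborel)
      \<le> liminf (\<lambda>n. \<integral>\<^sup>+y. ?E' n x y \<partial>lborel)"
      using f'(4)
    proof eventually_elim
      case (elim x)
      have "AE y in lborel. ennreal (f x powr a * g y powr a * h (x - y) powr s) = liminf (\<lambda>n. ?E' n x y)"
        using g'(4) AE_lborel_reflect[OF h'(4), of x]
      proof eventually_elim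
        case (elim y)
        \<comment> \<open>The limits may be 0, where continuity of a power needs the exponents
          \<open>a\<close> and \<open>s\<close> to be positive.\<close>
        have "(\<lambda>n. ?E' n x y) \<longlonglongrightarrow> ennreal (f x powr a * g y powr a * h (x - y) powr s)"
          using bounds f'(1) g'(1) h'(1)
          by (intro tendsto_ennrealI tendsto_mult tendsto_powr2 tendsto_const elim \<open>(\<lambda>n. f' n x) \<longlonglongrightarrow> f x\<close>)
            (auto intro!: always_eventually less_imp_le)
        then show ?case
          by (intro lim_imp_Liminf[symmetric]) auto
      qed
      then have "(\<integral>\<^sup>+y. ennreal (f x powr a * g y powr a * h (x - y) powr s) \<partial>lborel)
        = (\<integral>\<^sup>+y. liminf (\<lambda>n. ?E' n x y) \<partial>lborel)"
        by (rule nn_integral_cong_AE)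
      also have "\<dots> \<le> liminf (\<lambda>n. \<integral>\<^sup>+y. ?E' n x y \<partial>lborel)"
        by (rule nn_integral_liminf) measurable
      finally show ?case .
    qed
  qed
  also have "\<dots> \<le> liminf (\<lambda>n. \<integral>\<^sup>+x. \<integral>\<^sup>+y. ?E' n x y \<partial>lborel \<partial>lborel)"
    by (rule nn_integral_liminf) measurable
  also have "\<dots> \<le> liminf (\<lambda>n. ennreal (?R n))"
    by (intro Liminf_mono always_eventually allI young_positive f' g' h')
  also have "\<dots> = ennreal (C * (integral\<^sup>L lborel f powr a * integral\<^sup>L lborel g powr a * integral\<^sup>L lborel h powr s))"
    using bounds nonneg[OF f'(1)] nonneg[OF g'(1)] nonneg[OF h'(1)]
    by (intro lim_imp_Liminf tendsto_ennrealI tendsto_mult tendsto_powr2 tendsto_const f'(5) g'(5) h'(5))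
      (auto intro!: always_eventually)
  finally show ?thesis .
qed

end

subsection \<open>Tensorization\<close>

interpretation lborel_product: product_sigma_finite "\<lambda>_. lborel :: real measure"
  by standard

lemma integrable_gaussian_bound:
  fixes f :: "('i \<Rightarrow> real) \<Rightarrow> real"
  assumes "finite I" and "f \<in> borel_measurable (Pi\<^sub>M I (\<lambda>_. lborel))"
    and "\<And>x. 0 \<le> f x" "\<And>x. f x \<le> M * (\<Prod>i\<in>I. std_normal_density (x i))"
  shows "integrable (Pi\<^sub>M I (\<lambda>_. lborel)) f"
proof -
  have "integrable (Pi\<^sub>M I (\<lambda>_. lborel)) (\<lambda>x. M * (\<Prod>i\<in>I. std_normal_density (x i)))"
    using assms(1) by (intro integrable_mult_right lborel_product.product_integrable_prod) auto
  then show ?thesis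
    by (rule Bochner_Integration.integrable_bound) (use assms in \<open>auto intro!: AE_I2 order_trans[OF _ abs_ge_self]\<close>)
qed

text \<open>Separates coordinate \<open>i\<close> in the argument of \<open>h\<close>, so that the
  one-dimensional inequality applies to a slice.\<close>

lemma restrict_diff_fun_upd:
  fixes x y :: "'i \<Rightarrow> real"
  assumes "i \<notin> I"
  shows "(\<lambda>j\<in>insert i I. (x(i := u)) j - (y(i := v)) j) = (\<lambda>j\<in>I. x j - y j)(i := u - v)"
  using assms by (auto simp: restrict_def fun_eq_iff)

context young_exponents
begin

text \<open>Induction on the coordinates: with the others frozen, the one-dimensional inequality in
  coordinate \<open>i\<close> costs a factor \<open>C\<close> and replaces f, g, h by their
  marginals, to which the induction hypothesis applies.\<close>

lemma young_PiM:
  fixes f g h :: "('i \<Rightarrow> real) \<Rightarrow> real"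
  assumes "finite I"
    and "f \<in> borel_measurable (Pi\<^sub>M I (\<lambda>_. lborel))" "\<And>x. 0 \<le> f x"
    "\<And>x. f x \<le> M1 * (\<Prod>i\<in>I. std_normal_density (x i))"
    and "g \<in> borel_measurable (Pi\<^sub>M I (\<lambda>_. lborel))" "\<And>x. 0 \<le> g x"
    "\<And>x. g x \<le> M2 * (\<Prod>i\<in>I. std_normal_density (x i))"
    and "h \<in> borel_measurable (Pi\<^sub>M I (\<lambda>_. lborel))" "\<And>x. 0 \<le> h x"
    "\<And>x. h x \<le> M3 * (\<Prod>i\<in>I. std_normal_density (x i))"
  shows "(\<integral>\<^sup>+x. \<integral>\<^sup>+y. ennreal (f x powr a * g y powr a * h (\<lambda>i\<in>I. x i - y i) powr s)
        \<partial>Pi\<^sub>M I (\<lambda>_. lborel) \<partial>Pi\<^sub>M I (\<lambda>_. lborel))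
    \<le> ennreal (C ^ card I * (integral\<^sup>L (Pi\<^sub>M I (\<lambda>_. lborel)) f powr a *
        integral\<^sup>L (Pi\<^sub>M I (\<lambda>_. lborel)) g powr a * integral\<^sup>L (Pi\<^sub>M I (\<lambda>_. lborel)) h powr s))"
  using assms
proof (induction I arbitrary: f g h rule: finite_induct)
  case empty
  then show ?case
    by (simp add: PiM_empty nn_integral_count_space_finite lebesgue_integral_count_space_finite restrict_def)
next
  case (insert i I)
  let ?P = "Pi\<^sub>M I (\<lambda>_. lborel :: real measure)" and ?Q = "Pi\<^sub>M (insert i I) (\<lambda>_. lborel :: real measure)"
  define S where "S k x = (LINT u|lborel. k (x(i := u)))" for k :: "('i \<Rightarrow> real) \<Rightarrow> real" and x
  interpret P: sigma_finite_measure ?P by (rule lborel_product.sigma_finite) fact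
  interpret Q: sigma_finite_measure ?Q by (rule lborel_product.sigma_finite) (simp add: insert.hyps)
  interpret PL: pair_sigma_finite ?P "lborel :: real measure" by standard
  note prems = insert.prems
  note [measurable] = prems(1,4,7)
  have upd[measurable]: "(\<lambda>(x, u). x(i := u)) \<in> ?P \<Otimes>\<^sub>M lborel \<rightarrow>\<^sub>M ?Q"
    by (rule measurable_add_dim)
  have upd': "(\<lambda>w. (p w)(i := q w)) \<in> N \<rightarrow>\<^sub>M ?Q"
    if "p \<in> N \<rightarrow>\<^sub>M ?P" "q \<in> N \<rightarrow>\<^sub>M lborel" for N :: "'b measure" and p q
    using measurable_compose[OF measurable_Pair[OF that] upd] by simp
  have upd_const: "(\<lambda>u. x(i := u)) \<in> lborel \<rightarrow>\<^sub>M ?Q" if "x \<in> space ?P" for x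
    using measurable_component_update[OF that insert.hyps(2)] by simp
  have slice_measurable: "(\<lambda>u. k (x(i := u))) \<in> borel_measurable borel"
    if "x \<in> space ?P" "k \<in> borel_measurable ?Q" for k :: "('i \<Rightarrow> real) \<Rightarrow> real" and x
    using measurable_compose[OF upd_const[OF that(1)] that(2)] by (simp only: measurable_lborel2)
  have diff: "(\<lambda>w. \<lambda>j\<in>J. p w j - q w j) \<in> N \<rightarrow>\<^sub>M Pi\<^sub>M J (\<lambda>_. lborel)"
    if pq: "p \<in> N \<rightarrow>\<^sub>M Pi\<^sub>M J (\<lambda>_. lborel)" "q \<in> N \<rightarrow>\<^sub>M Pi\<^sub>M J (\<lambda>_. lborel)"
    for N :: "'b measure" and p q :: "'b \<Rightarrow> 'i \<Rightarrow> real" and J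
  proof (rule measurable_restrict)
    fix j assume "j \<in> J"
    note comp = measurable_component_singleton[OF this, of "\<lambda>_. lborel"]
    from measurable_compose[OF pq(1) comp] measurable_compose[OF pq(2) comp]
    show "(\<lambda>w. p w j - q w j) \<in> N \<rightarrow>\<^sub>M lborel" by simp
  qed
  have slice: "k (x(i := u)) \<le> M * (\<Prod>j\<in>I. std_normal_density (x j)) * std_normal_density u"
    if "\<And>x. k x \<le> M * (\<Prod>i\<in>insert i I. std_normal_density (x i))" for k M x u
  proof -
    have "(\<Prod>j\<in>I. std_normal_density ((x(i := u)) j)) = (\<Prod>j\<in>I. std_normal_density (x j))"
      using insert.hyps by (intro prod.cong) auto
    then show ?thesis using that[of "x(i := u)"] insert.hyps by (simp add: ac_simps)
  qed
  \<comment> \<open>Marginals keep the Gaussian bound with the same \<open>M\<close>, since the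
    Gaussian in the removed coordinate has mass 1; Fubini preserves the integral.\<close>
  have S: "S k \<in> borel_measurable ?P" "\<And>x. 0 \<le> S k x" "\<And>x. S k x \<le> M * (\<Prod>j\<in>I. std_normal_density (x j))"
    "integral\<^sup>L ?P (S k) = integral\<^sup>L ?Q k"
    if [measurable]: "k \<in> borel_measurable ?Q" and k: "\<And>x. 0 \<le> k x"
      "\<And>x. k x \<le> M * (\<Prod>i\<in>insert i I. std_normal_density (x i))" for k M
  proof -
    show "S k \<in> borel_measurable ?P"
      unfolding S_def by (rule lborel.borel_measurable_lebesgue_integral) (simp add: split_beta')
    show "0 \<le> S k x" for x unfolding S_def using k by simp
    show "S k x \<le> M * (\<Prod>j\<in>I. std_normal_density (x j))" for x
    proof -
      have "S k x \<le> (LINT u|lborel. M * (\<Prod>j\<in>I. std_normal_density (x j)) * std_normal_density u)"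
        unfolding S_def
        by (intro integral_mono' slice[OF k(2)] order_trans[OF k(1) slice[OF k(2)]]) auto
      then show ?thesis by simp
    qed
    show "integral\<^sup>L ?P (S k) = integral\<^sup>L ?Q k"
      unfolding S_def using insert.hyps k
      by (intro lborel_product.product_integral_insert[symmetric] integrable_gaussian_bound[where M=M]) auto
  qed
  let ?G = "\<lambda>x y. ennreal (f x powr a * g y powr a * h (\<lambda>i\<in>insert i I. x i - y i) powr s)"
  have G: "(\<lambda>w. ?G (p w) (q w)) \<in> borel_measurable N"
    if [measurable]: "p \<in> N \<rightarrow>\<^sub>M ?Q" "q \<in> N \<rightarrow>\<^sub>M ?Q" for N :: "'b measure" and p q
  proof -
    note [measurable] = measurable_compose[OF diff[OF that] prems(7)]
    show ?thesis by measurable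
  qed
  have "(\<integral>\<^sup>+x. \<integral>\<^sup>+y. ?G x y \<partial>?Q \<partial>?Q)
      = (\<integral>\<^sup>+x. \<integral>\<^sup>+u. (\<integral>\<^sup>+y. ?G (x(i := u)) y \<partial>?Q) \<partial>lborel \<partial>?P)"
    using insert.hyps G[OF measurable_fst measurable_snd]
    by (intro lborel_product.product_nn_integral_insert Q.borel_measurable_nn_integral) (auto simp: split_beta')
  also have "\<dots> = (\<integral>\<^sup>+x. \<integral>\<^sup>+u. \<integral>\<^sup>+y. \<integral>\<^sup>+v. ?G (x(i := u)) (y(i := v)) \<partial>lborel \<partial>?P \<partial>lborel \<partial>?P)"
  proof (intro nn_integral_cong lborel_product.product_nn_integral_insert insert.hyps)
    fix x and u :: real assume "x \<in> space ?P"
    from measurable_space[OF upd_const[OF this], of u] have "x(i := u) \<in> space ?Q" by simp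
    from G[OF measurable_const[OF this] measurable_ident]
    show "(\<lambda>y. ?G (x(i := u)) y) \<in> borel_measurable ?Q" by simp
  qed
  \<comment> \<open>The two integrals in coordinate \<open>i\<close> are brought together
    innermost.\<close>
  also have "\<dots> = (\<integral>\<^sup>+x. \<integral>\<^sup>+y. \<integral>\<^sup>+u. \<integral>\<^sup>+v. ?G (x(i := u)) (y(i := v)) \<partial>lborel \<partial>lborel \<partial>?P \<partial>?P)"
  proof (intro nn_integral_cong PL.Fubini')
    fix x assume x: "x \<in> space ?P"
    have "(\<lambda>w. \<integral>\<^sup>+v. ?G (x(i := snd w)) ((fst w)(i := v)) \<partial>lborel) \<in> borel_measurable (?P \<Otimes>\<^sub>M lborel)"
      unfolding split_beta'
      by (intro lborel.borel_measurable_nn_integral, unfold split_beta')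
        (intro G upd' measurable_const[OF x] measurable_compose[OF measurable_fst measurable_fst]
          measurable_compose[OF measurable_fst measurable_snd] measurable_snd)
    then show "(\<lambda>(y, u). \<integral>\<^sup>+v. ?G (x(i := u)) (y(i := v)) \<partial>lborel) \<in> borel_measurable (?P \<Otimes>\<^sub>M lborel)"
      by (simp add: split_beta')
  qed
  also have "\<dots> \<le> (\<integral>\<^sup>+x. \<integral>\<^sup>+y. ennreal (C * (S f x powr a * S g y powr a * S h (\<lambda>j\<in>I. x j - y j) powr s)) \<partial>?P \<partial>?P)"
  proof (intro nn_integral_mono)
    fix x y assume xy: "x \<in> space ?P" "y \<in> space ?P"
    then have d: "(\<lambda>j\<in>I. x j - y j) \<in> space ?P" by (auto simp: space_PiM)
    show "(\<integral>\<^sup>+u. \<integral>\<^sup>+v. ?G (x(i := u)) (y(i := v)) \<partial>lborel \<partial>lborel)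
      \<le> ennreal (C * (S f x powr a * S g y powr a * S h (\<lambda>j\<in>I. x j - y j) powr s))"
      unfolding restrict_diff_fun_upd[OF insert.hyps(2)] S_def
      by (rule young_real[OF slice_measurable[OF xy(1) prems(1)] slice_measurable[OF xy(2) prems(4)]
            slice_measurable[OF d prems(7)] prems(2) slice[OF prems(3)] prems(5) slice[OF prems(6)]
            prems(8) slice[OF prems(9)]])
  qed
  also have "\<dots> = ennreal C * (\<integral>\<^sup>+x. \<integral>\<^sup>+y. ennreal (S f x powr a * S g y powr a * S h (\<lambda>j\<in>I. x j - y j) powr s) \<partial>?P \<partial>?P)"
  proof -
    let ?H = "\<lambda>x y. ennreal (S f x powr a * S g y powr a * S h (\<lambda>j\<in>I. x j - y j) powr s)"
    have H: "(\<lambda>w. ?H (fst w) (snd w)) \<in> borel_measurable (?P \<Otimes>\<^sub>M ?P)"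
    proof -
      note [measurable] = S(1)[OF prems(1-3)] S(1)[OF prems(4-6)]
        measurable_compose[OF diff[OF measurable_fst measurable_snd] S(1)[OF prems(7-9)]]
      show ?thesis by measurable
    qed
    have "(\<integral>\<^sup>+x. \<integral>\<^sup>+y. ennreal (C * (S f x powr a * S g y powr a * S h (\<lambda>j\<in>I. x j - y j) powr s)) \<partial>?P \<partial>?P)
        = (\<integral>\<^sup>+x. ennreal C * (\<integral>\<^sup>+y. ?H x y \<partial>?P) \<partial>?P)"
    proof (rule nn_integral_cong)
      fix x assume x: "x \<in> space ?P"
      have "?H x \<in> borel_measurable ?P"
        using measurable_Pair2[OF H x] by (simp only: fst_conv snd_conv)
      have "ennreal C * (\<integral>\<^sup>+y. ?H x y \<partial>?P) = (\<integral>\<^sup>+y. ennreal C * ?H x y \<partial>?P)"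
        by (rule nn_integral_cmult[symmetric]) fact
      also have "\<dots> = (\<integral>\<^sup>+y. ennreal (C * (S f x powr a * S g y powr a * S h (\<lambda>j\<in>I. x j - y j) powr s)) \<partial>?P)"
        using C_pos by (intro nn_integral_cong) (simp only: ennreal_mult' less_imp_le)
      finally show "(\<integral>\<^sup>+y. ennreal (C * (S f x powr a * S g y powr a * S h (\<lambda>j\<in>I. x j - y j) powr s)) \<partial>?P)
        = ennreal C * (\<integral>\<^sup>+y. ?H x y \<partial>?P)" by (rule sym)
    qed
    also have "\<dots> = ennreal C * (\<integral>\<^sup>+x. \<integral>\<^sup>+y. ?H x y \<partial>?P \<partial>?P)"
      using H by (intro nn_integral_cmult P.borel_measurable_nn_integral) (simp add: split_beta')
    finally show ?thesis .
  qed
  also have "\<dots> \<le> ennreal C * ennreal (C ^ card I * (integral\<^sup>L ?P (S f) powr a * integral\<^sup>L ?P (S g) powr a * integral\<^sup>L ?P (S h) powr s))"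
    by (intro mult_left_mono
        insert.IH[OF S(1-3)[OF prems(1-3)] S(1-3)[OF prems(4-6)] S(1-3)[OF prems(7-9)]]) auto
  also have "\<dots> = ennreal (C ^ card (insert i I) * (integral\<^sup>L ?Q f powr a * integral\<^sup>L ?Q g powr a * integral\<^sup>L ?Q h powr s))"
    using C_pos insert.hyps by (simp add: S(4)[OF prems(1-3)] S(4)[OF prems(4-6)] S(4)[OF prems(7-9)] ennreal_mult'[symmetric] ac_simps)
  finally show ?case .
qed

end

subsection \<open>Pairs of points of a convex body\<close>

text \<open>The infimum is not known in advance to be attained: convexity with 0 in \<open>K\<close>
  gives z in cK for every c > t, and closedness allows c to tend to t.\<close>

lemma gauge_norm_leD:
  fixes K :: "'a::euclidean_space set"
  assumes "closed K" "convex K" and "0 \<in> interior K" and "t > 0" and le: "gauge_norm K z \<le> t"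
  shows "z \<in> (\<lambda>v. t *\<^sub>R v) ` K"
proof -
  define A where "A = {r. r > 0 \<and> z \<in> (\<lambda>v. r *\<^sub>R v) ` K}"
  have "0 \<in> K" using assms(3) interior_subset by blast
  obtain e where e: "e > 0" "ball 0 e \<subseteq> K" using assms(3) mem_interior by blast
  \<comment> \<open>Scaling by \<open>r\<close> brings z into the ball of radius \<open>e\<close>,
    so the set under the infimum is nonempty.\<close>
  define r where "r = (norm z + 1) / e"
  have "r > 0" using e by (simp add: r_def add_nonneg_pos)
  have "norm (z /\<^sub>R r) = norm z / (norm z + 1) * e" using \<open>r > 0\<close> e by (simp add: r_def field_simps)
  also have "\<dots> < 1 * e" using e by (intro mult_strict_right_mono) (auto simp: divide_less_eq add_nonneg_pos)
  finally have "z /\<^sub>R r \<in> K" using e by auto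
  then have "r \<in> A" using \<open>r > 0\<close> by (auto simp: A_def intro!: image_eqI[of _ _ "z /\<^sub>R r"])
  have in_K: "z /\<^sub>R c \<in> K" if "c > t" for c
  proof -
    have "Inf A < c" using le that by (simp add: gauge_norm_def A_def)
    then obtain q where "q \<in> A" "q < c" using \<open>r \<in> A\<close> by (metis cInf_lessD empty_iff)
    then obtain v where v: "q > 0" "v \<in> K" "z = q *\<^sub>R v" by (auto simp: A_def)
    \<comment> \<open>The point z / c lies on the segment from 0 to v because q < c.\<close>
    have "(q / c) *\<^sub>R v + (1 - q / c) *\<^sub>R 0 \<in> K"
      using v \<open>q < c\<close> \<open>0 \<in> K\<close> by (intro convexD[OF assms(2)]) auto
    then show ?thesis using v by (simp add: divide_inverse mult.commute)
  qed
  have "(\<lambda>n. t + inverse (real (Suc n))) \<longlonglongrightarrow> t"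
    using tendsto_add[OF tendsto_const LIMSEQ_inverse_real_of_nat, of t] by simp
  then have "(\<lambda>n. z /\<^sub>R (t + inverse (real (Suc n)))) \<longlonglongrightarrow> z /\<^sub>R t"
    using \<open>t > 0\<close> by (intro tendsto_intros) auto
  then have "z /\<^sub>R t \<in> K"
    by (rule closed_sequentially[OF assms(1), rotated]) (rule in_K, simp)
  then show ?thesis using \<open>t > 0\<close> by (auto intro!: image_eqI[of _ _ "z /\<^sub>R t"])
qed

text \<open>On a bounded set all coordinates are at most R in absolute value, so each Gaussian
  factor is at least its value at R. This supplies the domination needed for
  \<open>young_PiM\<close>.\<close>

lemma indicator_le_gaussian:
  fixes A :: "'a::euclidean_space set"
  assumes "bounded A"
  obtains M where "\<And>x :: 'a \<Rightarrow> real. indicator A (\<Sum>b\<in>Basis. x b *\<^sub>R b) \<le> M * (\<Prod>b\<in>Basis. std_normal_density (x b))"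
proof -
  obtain R where R: "\<And>x. x \<in> A \<Longrightarrow> norm x \<le> R" using assms by (auto simp: bounded_iff)
  define c where "c = std_normal_density R"
  have "c > 0" by (simp add: c_def normal_density_pos)
  have "indicator A (\<Sum>b\<in>Basis. x b *\<^sub>R b) \<le> 1 / c ^ DIM('a) * (\<Prod>b\<in>Basis. std_normal_density (x b))"
    for x :: "'a \<Rightarrow> real"
  proof (cases "(\<Sum>b\<in>Basis. x b *\<^sub>R b) \<in> A")
    case True
    have "c \<le> std_normal_density (x b)" if "b \<in> Basis" for b
    proof -
      have "\<bar>x b\<bar> \<le> R"
        using Basis_le_norm[OF that, of "\<Sum>b\<in>Basis. x b *\<^sub>R b"] R[OF True] that by simp
      then have "(x b)\<^sup>2 \<le> R\<^sup>2" by (metis abs_le_square_iff abs_of_nonneg abs_ge_zero order_trans)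
      then show ?thesis by (simp add: c_def std_normal_density_def divide_right_mono)
    qed
    then have "(\<Prod>b\<in>(Basis::'a set). c) \<le> (\<Prod>b\<in>Basis. std_normal_density (x b))"
      using \<open>c > 0\<close> by (intro prod_mono) auto
    then show ?thesis using True \<open>c > 0\<close> by (simp add: field_simps)
  next
    case False
    then show ?thesis using \<open>c > 0\<close> by (auto intro!: divide_nonneg_pos prod_nonneg)
  qed
  then show ?thesis by (rule that)
qed

context young_exponents
begin

text \<open>Lebesgue measure is the image of the product measure under the coordinate map
  \<open>e\<close>; indicators are unchanged by the powers \<open>a\<close> and \<open>s\<close>, so
  their integrals are volumes.\<close>

lemma young_sets:
  fixes A B D :: "'a::euclidean_space set"
  assumes "bounded A" "bounded B" "bounded D"
    and [measurable]: "A \<in> sets borel" "B \<in> sets borel" "D \<in> sets borel"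
  shows "(\<integral>\<^sup>+x. \<integral>\<^sup>+y. indicator A x * indicator B y * indicator D (x - y) \<partial>lborel \<partial>lborel)
    \<le> ennreal (C ^ DIM('a) * (measure lborel A powr a * measure lborel B powr a * measure lborel D powr s))"
proof -
  let ?P = "Pi\<^sub>M (Basis::'a set) (\<lambda>_. lborel :: real measure)"
  define e where "e x = (\<Sum>b\<in>Basis. x b *\<^sub>R b)" for x :: "'a \<Rightarrow> real"
  have [measurable]: "e \<in> ?P \<rightarrow>\<^sub>M borel"
    unfolding e_def by measurable
  have lborel: "(lborel :: 'a measure) = distr ?P borel e"
    unfolding e_def[abs_def] by (rule lborel_eq)
  have trans: "(\<integral>\<^sup>+x. k x \<partial>(lborel :: 'a measure)) = (\<integral>\<^sup>+x. k (e x) \<partial>?P)"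
    if [measurable]: "k \<in> borel_measurable borel" for k
    by (subst lborel) (simp add: nn_integral_distr)
  have meas: "integral\<^sup>L ?P (\<lambda>x. indicator X (e x) :: real) = measure lborel X" if [measurable]: "X \<in> sets borel" for X
  proof -
    have "measure lborel X = integral\<^sup>L (distr ?P borel e) (indicator X)"
      by (subst lborel[symmetric]) simp
    also have "\<dots> = integral\<^sup>L ?P (\<lambda>x. indicator X (e x) :: real)"
      by (rule integral_distr) auto
    finally show ?thesis by simp
  qed
  obtain M1 where M1: "\<And>x. indicator A (e x) \<le> M1 * (\<Prod>b\<in>Basis. std_normal_density (x b))"
    using indicator_le_gaussian[OF assms(1)] unfolding e_def by blast
  obtain M2 where M2: "\<And>x. indicator B (e x) \<le> M2 * (\<Prod>b\<in>Basis. std_normal_density (x b))"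
    using indicator_le_gaussian[OF assms(2)] unfolding e_def by blast
  obtain M3 where M3: "\<And>x. indicator D (e x) \<le> M3 * (\<Prod>b\<in>Basis. std_normal_density (x b))"
    using indicator_le_gaussian[OF assms(3)] unfolding e_def by blast
  have diff: "e (\<lambda>b\<in>Basis. x b - y b) = e x - e y" for x y
    unfolding e_def by (simp add: sum_subtractf[symmetric] scaleR_diff_left)
  have pw: "(indicator X x :: real) powr a = indicator X x" "(indicator X x :: real) powr s = indicator X x"
    for X and x :: 'a
    using bounds by (auto split: split_indicator)
  have "(\<integral>\<^sup>+x. \<integral>\<^sup>+y. indicator A x * indicator B y * indicator D (x - y) \<partial>lborel \<partial>lborel)
    = (\<integral>\<^sup>+x. \<integral>\<^sup>+y. indicator A (e x) * indicator B y * indicator D (e x - y) \<partial>lborel \<partial>?P)"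
    by (rule trans) measurable
  also have "\<dots> = (\<integral>\<^sup>+x. \<integral>\<^sup>+y. indicator A (e x) * indicator B (e y) * indicator D (e x - e y) \<partial>?P \<partial>?P)"
    by (intro nn_integral_cong trans) measurable
  also have "\<dots> = (\<integral>\<^sup>+x. \<integral>\<^sup>+y. ennreal (indicator A (e x) powr a * indicator B (e y) powr a
      * indicator D (e (\<lambda>b\<in>Basis. x b - y b)) powr s) \<partial>?P \<partial>?P)"
    unfolding pw diff by (intro nn_integral_cong) (auto split: split_indicator)
  also have "\<dots> \<le> ennreal (C ^ DIM('a) * (measure lborel A powr a * measure lborel B powr a * measure lborel D powr s))"
    unfolding meas[symmetric, OF assms(4)] meas[symmetric, OF assms(5)] meas[symmetric, OF assms(6)]
    by (rule young_PiM[OF finite_Basis _ _ M1 _ _ M2 _ _ M3]) auto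
  finally show ?thesis .
qed

end

theorem theorem24:
  fixes K :: "'a::euclidean_space set" and t :: real
  assumes "convex_body K" and "0 \<in> interior K"
    and "0 < t" and "t < sqrt 2"
  shows "measure (uniform_measure lborel K \<Otimes>\<^sub>M uniform_measure lborel K)
           {(x, y). x \<in> K \<and> y \<in> K \<and> gauge_norm K (x - y) \<le> t}
         \<le> (t\<^sup>2 * (4 - t\<^sup>2) / 4) powr (real DIM('a) / 2)"
proof -
  have K: "compact K" "convex K" using assms(1) by (auto simp: convex_body_def)
  define D where "D = (\<lambda>v. t *\<^sub>R v) ` K"
  have D: "compact D" unfolding D_def using K(1) by (rule compact_scaling)
  have [measurable]: "K \<in> sets borel" "D \<in> sets borel"
    using K D by (auto intro: borel_compact)
  define V where "V = measure lborel K"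
  have emK: "emeasure lborel K = ennreal V"
    unfolding V_def using emeasure_compact_finite[OF K(1)] by (simp add: emeasure_eq_ennreal_measure less_top)
  have "V > 0"
  proof -
    obtain e where e: "e > 0" "ball 0 e \<subseteq> K" using assms(2) mem_interior by blast
    have "0 < measure lborel (ball (0::'a) e)" using e content_ball_pos by simp
    also have "\<dots> \<le> V"
      unfolding V_def using e emK
      by (intro measure_mono_fmeasurable) (auto simp: fmeasurable_def)
    finally show ?thesis .
  qed
  have mD: "measure lborel D = t ^ DIM('a) * V"
    using measure_lebesgue_affine[of t "0::'a" K] \<open>0 < t\<close> by (simp add: D_def[symmetric] V_def measure_completion)

  \<comment> \<open>Solves sqrt (2\<rho> / a) = t with a = (1 + \<rho>) / 2; \<rho> < 1 amounts to t
    < sqrt 2. For general \<rho> the factor \<open>C * t powr (1 - \<rho>)\<close> per dimension has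
    logarithmic derivative ln (\<sigma> / t) in \<rho>, so it is smallest where \<sigma> =
    t.\<close>
  define \<rho> where "\<rho> = t\<^sup>2 / (4 - t\<^sup>2)"
  define a where "a = (1 + \<rho>) / 2"
  have "t\<^sup>2 < 2" using power_strict_mono[OF assms(4), of 2] assms(3) by simp
  then have rho: "0 < \<rho>" "\<rho> < 1" using assms(3) by (auto simp: \<rho>_def)
  have a: "a = 2 / (4 - t\<^sup>2)" using \<open>t\<^sup>2 < 2\<close> by (simp add: a_def \<rho>_def field_simps)
  have "2 * \<rho> / a = t\<^sup>2" unfolding a using \<open>t\<^sup>2 < 2\<close> by (simp add: \<rho>_def)
  then have "sqrt (2 * \<rho> / a) = t" using assms(3) by simp
  then interpret young_exponents \<rho> a "1 - \<rho>" t
    using rho by unfold_locales (auto simp: a_def)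
  \<comment> \<open>At \<sigma> = t the powers of t cancel, leaving sqrt \<rho> / a.\<close>
  have C: "C * t powr (1 - \<rho>) = sqrt (t\<^sup>2 * (4 - t\<^sup>2) / 4)"
  proof -
    have "C * t powr (1 - \<rho>) = sqrt \<rho> / a"
      using assms(3) by (simp add: C_def powr_add[symmetric] mult.assoc)
    also have "\<dots> = sqrt (\<rho> / a\<^sup>2)" using bounds by (simp add: real_sqrt_divide)
    also have "\<rho> / a\<^sup>2 = t\<^sup>2 * (4 - t\<^sup>2) / 4"
      unfolding a using \<open>t\<^sup>2 < 2\<close> by (simp add: \<rho>_def power2_eq_square field_simps)
    finally show ?thesis .
  qed

  let ?U = "uniform_measure lborel K"
  interpret U: prob_space ?U
    using emK \<open>V > 0\<close> by (intro prob_space_uniform_measure) auto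
  interpret UU: pair_prob_space ?U ?U ..
  define S where "S = {(x, y). x \<in> K \<and> y \<in> K \<and> x - y \<in> D}"
  have S[measurable]: "S \<in> sets (?U \<Otimes>\<^sub>M ?U)"
  proof -
    have "{w \<in> space (borel \<Otimes>\<^sub>M borel). fst w \<in> K \<and> snd w \<in> K \<and> fst w - snd w \<in> D}
        \<in> sets (borel \<Otimes>\<^sub>M borel :: ('a \<times> 'a) measure)"
      by measurable
    also have "{w \<in> space (borel \<Otimes>\<^sub>M borel). fst w \<in> K \<and> snd w \<in> K \<and> fst w - snd w \<in> D} = S"
      by (auto simp: S_def space_pair_measure)
    finally show ?thesis by simp
  qed
  have "measure (?U \<Otimes>\<^sub>M ?U) {(x, y). x \<in> K \<and> y \<in> K \<and> gauge_norm K (x - y) \<le> t} \<le> measure (?U \<Otimes>\<^sub>M ?U) S"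
    (is "measure _ ?T \<le> _")
  \<comment> \<open>A set outside the sigma-algebra has \<open>measure\<close> 0 by convention, so
    monotonicity is needed only in the measurable case.\<close>
  proof (cases "?T \<in> sets (?U \<Otimes>\<^sub>M ?U)")
    case True
    have "?T \<subseteq> S"
      using gauge_norm_leD[OF compact_imp_closed[OF K(1)] K(2) assms(2,3)] by (auto simp: S_def D_def)
    then show ?thesis by (intro UU.finite_measure_mono S)
  next
    case False
    then show ?thesis by (simp add: measure_notin_sets)
  qed
  also have "measure (?U \<Otimes>\<^sub>M ?U) S \<le> (C * t powr (1 - \<rho>)) ^ DIM('a)"
  proof -
    have "emeasure (?U \<Otimes>\<^sub>M ?U) S = (\<integral>\<^sup>+x. \<integral>\<^sup>+y. indicator S (x, y) \<partial>?U \<partial>?U)"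
      by (subst U.nn_integral_fst) (simp_all only: nn_integral_indicator[OF S] borel_measurable_indicator[OF S])
    also have "\<dots> = (\<integral>\<^sup>+x. \<integral>\<^sup>+y. indicator K x * indicator K y * indicator D (x - y) \<partial>lborel \<partial>lborel) / ennreal V / ennreal V"
    proof -
      have "(\<integral>\<^sup>+y. indicator S (x, y) \<partial>?U) * indicator K x
          = (\<integral>\<^sup>+y. indicator K x * indicator K y * indicator D (x - y) \<partial>lborel) / ennreal V" for x
      proof -
        have [measurable]: "Pair x -` S \<in> sets borel"
          using sets_Pair1[OF S, of x] by simp
        have "(\<integral>\<^sup>+y. indicator S (x, y) \<partial>?U) = (\<integral>\<^sup>+y. indicator (Pair x -` S) y \<partial>?U)"
          by (intro nn_integral_cong) (auto split: split_indicator)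
        also have "\<dots> = (\<integral>\<^sup>+y. indicator (Pair x -` S) y * indicator K y \<partial>lborel) / ennreal V"
          unfolding emK[symmetric] by (rule nn_integral_uniform_measure) auto
        also have "\<dots> * indicator K x = (\<integral>\<^sup>+y. indicator K x * indicator K y * indicator D (x - y) \<partial>lborel) / ennreal V"
          by (cases "x \<in> K") (auto simp: S_def intro!: arg_cong2[where f="(/)"] nn_integral_cong split: split_indicator)
        finally show ?thesis .
      qed
      moreover have "(\<integral>\<^sup>+x. \<integral>\<^sup>+y. indicator S (x, y) \<partial>?U \<partial>?U)
        = (\<integral>\<^sup>+x. (\<integral>\<^sup>+y. indicator S (x, y) \<partial>?U) * indicator K x \<partial>lborel) / ennreal V"
        unfolding emK[symmetric]
      proof (rule nn_integral_uniform_measure)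
        show "(\<lambda>x. \<integral>\<^sup>+y. indicator S (x, y) \<partial>?U) \<in> borel_measurable lborel"
          using U.borel_measurable_nn_integral_fst[OF borel_measurable_indicator[OF S]] by simp
      qed simp
      ultimately have "(\<integral>\<^sup>+x. \<integral>\<^sup>+y. indicator S (x, y) \<partial>?U \<partial>?U)
        = (\<integral>\<^sup>+x. (\<integral>\<^sup>+y. indicator K x * indicator K y * indicator D (x - y) \<partial>lborel) / ennreal V \<partial>lborel) / ennreal V"
        by simp
      also have "\<dots> = (\<integral>\<^sup>+x. \<integral>\<^sup>+y. indicator K x * indicator K y * indicator D (x - y) \<partial>lborel \<partial>lborel) / ennreal V / ennreal V"
        by (subst nn_integral_divide) measurable
      finally show ?thesis .
    qed
    also have "\<dots> \<le> ennreal (C ^ DIM('a) * (V powr a * V powr a * (t ^ DIM('a) * V) powr (1 - \<rho>))) / ennreal V / ennreal V"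
      using young_sets[of K K D] K D unfolding mD V_def[symmetric]
      by (intro divide_right_mono_ennreal) (auto intro: compact_imp_bounded)
    \<comment> \<open>The powers of V add up to 2a + s = 2, which exactly cancels the two
      normalizations by V.\<close>
    also have "C ^ DIM('a) * (V powr a * V powr a * (t ^ DIM('a) * V) powr (1 - \<rho>))
       = (C * t powr (1 - \<rho>)) ^ DIM('a) * V * V"
    proof -
      have "V powr a * V powr a * V powr (1 - \<rho>) = V powr 2"
        by (simp add: powr_add[symmetric] a_def)
      moreover have "V powr 2 = V * V" using \<open>V > 0\<close> by (simp add: powr_numeral power2_eq_square)
      moreover have "(t ^ DIM('a)) powr (1 - \<rho>) = (t powr (1 - \<rho>)) ^ DIM('a)"
        using assms(3) by (simp add: powr_realpow[symmetric] powr_powr mult.commute)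
      ultimately show ?thesis
        using assms(3) \<open>V > 0\<close> by (simp add: powr_mult power_mult_distrib mult_ac)
    qed
    finally have "emeasure (?U \<Otimes>\<^sub>M ?U) S \<le> ennreal ((C * t powr (1 - \<rho>)) ^ DIM('a))"
      using \<open>V > 0\<close> C_pos assms(3) by (simp add: divide_ennreal)
    then show ?thesis
      using C_pos assms(3) by (simp add: UU.emeasure_eq_measure)
  qed
  also have "\<dots> = (t\<^sup>2 * (4 - t\<^sup>2) / 4) powr (real DIM('a) / 2)"
  proof -
    let ?X = "t\<^sup>2 * (4 - t\<^sup>2) / 4"
    have "?X > 0" using \<open>t\<^sup>2 < 2\<close> assms(3) by simp
    then have "sqrt ?X ^ DIM('a) = (?X powr (1 / 2)) powr real DIM('a)"
      by (simp only: powr_half_sqrt less_imp_le) (simp add: powr_realpow)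
    then show ?thesis unfolding C by (simp add: powr_powr)
  qed
  finally show ?thesis .
qed

end
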